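(* Let $R$ be a commutative ring with unity and let $M$ be an $R$-module. Then the following statements hold. (i) $\widetilde{V}(\{\{1\}\})=\emptyset$, i.e. the set $\widetilde{V}(\mathcal{S})$ for the family $\mathcal{S}$ whose only member is the multiplicatively closed set $\{1\}$ is empty. (ii) $\widetilde{V}(\mathcal{S})=\operatorname{Spec}(M)$ if $\mathcal{S}=\{S_i\}_{i\in I}$ with $I=\emptyset$. (iii) If $\mathcal{S}_j$ is a family of multiplicatively closed subsets of $R$ for every $j\in J$, then $\bigcap_{j\in J}\widetilde{V}(\mathcal{S}_j)=\widetilde{V}\left(\bigcup_{j\in J}\mathcal{S}_j\right)$. (iv) If $\mathcal{S}$ and $\mathcal{S}'$ are families of multiplicatively closed subsets of $R$, then $\widetilde{V}(\mathcal{S})\cup\widetilde{V}(\mathcal{S}')=\widetilde{V}(\mathcal{T})$, where $\mathcal{T}=\{R-(P:M) \mid P\in\operatorname{Spec}(M),\ (P:M)\cap A=\emptyset \text{ and } (P:M)\cap A'=\emptyset \text{ for some } A\in\mathcal{S} \text{ and } A'\in\mathcal{S}'\}$.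
   Context: For a submodule $N$ of an $R$-module $M$, $(N:M)=\{r\in R : rM\subseteq N\}$. A proper submodule $P$ of $M$ is prime if whenever $rm\in P$ with $r\in R$, $m\in M$, then $m\in P$ or $r\in(P:M)$; in this case $(P:M)$ is a prime ideal of $R$. $\operatorname{Spec}(M)$ is the set of all prime submodules of $M$. A subset $T\subseteq R$ is multiplicatively closed if $1\in T$ and $xy\in T$ whenever $x,y\in T$. For a family $\mathcal{S}=\{S_i\}_{i\in I}$ of multiplicatively closed subsets of $R$, $\widetilde{V}(\mathcal{S})=\{P\in\operatorname{Spec}(M) \mid (P:M)\cap S_i\neq\emptyset \text{ for all } i\in I\}$. $R-(P:M)$ is the set complement of $(P:M)$ in $R$. In (iii), $\bigcup_{j\in J}\mathcal{S}_j$ is the union of the families, i.e. the family of all multiplicatively closed sets belonging to some $\mathcal{S}_j$ (an empty intersection of subsets of $\operatorname{Spec}(M)$ is $\operatorname{Spec}(M)$). *)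

theory Defs
  imports "HOL-Algebra.Algebra"
begin

definition colon :: "('a, 'r) ring_scheme \<Rightarrow> ('a, 'b, 'm) module_scheme \<Rightarrow> 'b set \<Rightarrow> 'a set" where
  "colon R M N = {r \<in> carrier R. \<forall>m \<in> carrier M. r \<odot>\<^bsub>M\<^esub> m \<in> N}"

definition prime_submodule ::
    "('a, 'r) ring_scheme \<Rightarrow> ('a, 'b, 'm) module_scheme \<Rightarrow> 'b set \<Rightarrow> bool" where
  "prime_submodule R M P \<longleftrightarrow>
     submodule P R M \<and> P \<noteq> carrier M \<and>
     (\<forall>r \<in> carrier R. \<forall>m \<in> carrier M. r \<odot>\<^bsub>M\<^esub> m \<in> P \<longrightarrow> m \<in> P \<or> r \<in> colon R M P)"

definition Spec :: "('a, 'r) ring_scheme \<Rightarrow> ('a, 'b, 'm) module_scheme \<Rightarrow> 'b set set" where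
  "Spec R M = {P. prime_submodule R M P}"

(* A multiplicatively closed subset of R (containing 1) is a submonoid of the multiplicative
   monoid of R, that is, "submonoid S R". A family of such subsets is represented by the set of
   its members, since the condition below does not depend on the indexing. *)
definition V_tilde ::
    "('a, 'r) ring_scheme \<Rightarrow> ('a, 'b, 'm) module_scheme \<Rightarrow> 'a set set \<Rightarrow> 'b set set" where
  "V_tilde R M \<S> = {P \<in> Spec R M. \<forall>S \<in> \<S>. colon R M P \<inter> S \<noteq> {}}"

lemma (in module) colon_prime_submodule_primeideal:
  assumes "prime_submodule R M P"
  shows "primeideal (colon R M P) R"
proof -
  have P: "submodule P R M" "P \<noteq> carrier M"
    and prime: "\<And>r m. \<lbrakk>r \<in> carrier R; m \<in> carrier M; r \<odot>\<^bsub>M\<^esub> m \<in> P\<rbrakk> \<Longrightarrow> m \<in> P \<or> r \<in> colon R M P"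
    using assms by (auto simp: prime_submodule_def)
  note E = submoduleE[OF P(1)]
  have zero: "\<zero>\<^bsub>M\<^esub> \<in> P"
    using subgroup.one_closed[OF submodule.axioms(1)[OF P(1)]] by simp
  have id: "ideal (colon R M P) R"
  proof (rule idealI)
    show "subgroup (colon R M P) (add_monoid R)"
    proof (rule R.add.subgroupI)
      show "colon R M P \<noteq> {}"
        using zero by (auto simp: colon_def intro!: exI[of _ "\<zero>"])
    next
      fix a assume "a \<in> colon R M P"
      then show "\<ominus> a \<in> colon R M P"
        using E(3) by (auto simp: colon_def smult_l_minus)
    qed (auto simp: colon_def smult_l_distr intro: E(5))
  next
    fix a x assume a: "a \<in> colon R M P" and x: "x \<in> carrier R"
    then show *: "x \<otimes> a \<in> colon R M P"
      using E(4) by (auto simp: colon_def smult_assoc1)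
    have "a \<otimes> x = x \<otimes> a" using a x by (auto simp: colon_def R.m_comm)
    with * show "a \<otimes> x \<in> colon R M P" by simp
  qed (rule R.ring_axioms)
  show ?thesis
  proof (rule primeidealI[OF id R.is_cring])
    show "carrier R \<noteq> colon R M P"
    proof
      assume "carrier R = colon R M P"
      then have "\<one> \<in> colon R M P" by auto
      then have "carrier M \<subseteq> P" by (auto simp: colon_def)
      with E(1) P(2) show False by blast
    qed
  next
    fix a b assume ab: "a \<in> carrier R" "b \<in> carrier R" "a \<otimes> b \<in> colon R M P"
    show "a \<in> colon R M P \<or> b \<in> colon R M P"
    proof (rule disjCI)
      assume "b \<notin> colon R M P"
      then obtain m where m: "m \<in> carrier M" "b \<odot>\<^bsub>M\<^esub> m \<notin> P"
        using ab by (auto simp: colon_def)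
      have "a \<odot>\<^bsub>M\<^esub> (b \<odot>\<^bsub>M\<^esub> m) \<in> P"
        using ab m by (auto simp: colon_def smult_assoc1)
      with prime[of a "b \<odot>\<^bsub>M\<^esub> m"] ab m show "a \<in> colon R M P" by auto
    qed
  qed
qed

lemma (in module) submonoid_compl_colon:
  assumes "prime_submodule R M P"
  shows "submonoid (carrier R - colon R M P) R"
proof -
  interpret P: primeideal "colon R M P" R
    by (rule colon_prime_submodule_primeideal[OF assms])
  show ?thesis
    using P.I_prime P.I_notcarr P.one_imp_carrier by unfold_locales auto
qed

end

theory Submission
  imports Defs
begin

text \<open>For prime P the ideal (P:M) is prime, hence proper, so it misses {1}; this gives (i).
  Parts (ii) and (iii) only rearrange the quantifier over members of a family. The content is (iv),
  \<open>V_tilde_Un\<close>: the complement of (P:M) is the largest subset of R that (P:M) misses,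
  so meeting A or A', both missed by (P:M), forces meeting that complement. Conversely, a prime Q
  outside both sets on the left puts the complement of its own (Q:M) into the new family, and (Q:M)
  cannot meet that.\<close>

lemma (in module) one_notin_colon:
  assumes "prime_submodule R M P"
  shows "\<one> \<notin> colon R M P"
proof -
  interpret P: primeideal "colon R M P" R
    by (rule colon_prime_submodule_primeideal[OF assms])
  show ?thesis
    using P.I_notcarr P.one_imp_carrier by auto
qed

lemma (in module) V_tilde_one: "V_tilde R M {{\<one>}} = {}"
  using one_notin_colon by (auto simp: V_tilde_def Spec_def)

lemma V_tilde_empty: "V_tilde R M {} = Spec R M"
  by (simp add: V_tilde_def)

text \<open>An empty \<open>\<Inter>\<close> in HOL is \<open>UNIV\<close>; the factor
  \<open>Spec R M\<close> gives it the intended value when J is empty and changes nothing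
  otherwise.\<close>

lemma V_tilde_UN: "V_tilde R M (\<Union>j \<in> J. \<S> j) = Spec R M \<inter> (\<Inter>j \<in> J. V_tilde R M (\<S> j))"
  by (auto simp: V_tilde_def)

lemma V_tilde_Un:
  "V_tilde R M \<S> \<union> V_tilde R M \<S>' =
   V_tilde R M {carrier R - colon R M P | P.
     P \<in> Spec R M \<and> (\<exists>A \<in> \<S>. \<exists>A' \<in> \<S>'. colon R M P \<inter> A = {} \<and> colon R M P \<inter> A' = {})}"
  (is "_ = V_tilde R M ?\<T>")
proof (intro equalityI subsetI)
  fix Q
  assume "Q \<in> V_tilde R M \<S> \<union> V_tilde R M \<S>'"
  then have Q: "Q \<in> Spec R M"
    and meet: "(\<forall>A \<in> \<S>. colon R M Q \<inter> A \<noteq> {}) \<or> (\<forall>A \<in> \<S>'. colon R M Q \<inter> A \<noteq> {})"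
    by (auto simp: V_tilde_def)
  have sub: "colon R M Q \<subseteq> carrier R"
    by (auto simp: colon_def)
  have "colon R M Q \<inter> T \<noteq> {}" if "T \<in> ?\<T>" for T
  proof -
    from that obtain P A A' where T: "T = carrier R - colon R M P" and "A \<in> \<S>" "A' \<in> \<S>'"
      and disj: "colon R M P \<inter> A = {}" "colon R M P \<inter> A' = {}"
      by blast
    with meet have "colon R M Q \<inter> A \<noteq> {} \<or> colon R M Q \<inter> A' \<noteq> {}"
      by blast
    \<comment> \<open>A common element of (Q:M) and A (or A') lies in R by \<open>sub\<close> and
      outside (P:M) by \<open>disj\<close>, hence in T.\<close>
    with sub disj show ?thesis
      unfolding T by blast
  qed
  with Q show "Q \<in> V_tilde R M ?\<T>"
    unfolding V_tilde_def by blast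
next
  fix Q
  assume Q: "Q \<in> V_tilde R M ?\<T>"
  show "Q \<in> V_tilde R M \<S> \<union> V_tilde R M \<S>'"
  proof (rule ccontr)
    assume "Q \<notin> V_tilde R M \<S> \<union> V_tilde R M \<S>'"
    \<comment> \<open>Q itself serves as P: failing both memberships yields A and A' that (Q:M)
      misses.\<close>
    with Q have "carrier R - colon R M Q \<in> ?\<T>"
      unfolding V_tilde_def by blast
    with Q have "colon R M Q \<inter> (carrier R - colon R M Q) \<noteq> {}"
      unfolding V_tilde_def by blast
    then show False
      by blast
  qed
qed

theorem theorem1:
  fixes R :: "('a, 'r) ring_scheme" and M :: "('a, 'b, 'm) module_scheme"
  assumes "module R M"
  shows
    "V_tilde R M {{\<one>\<^bsub>R\<^esub>}} = {}
     \<and> V_tilde R M {} = Spec R M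
     \<and> (\<forall>(J :: 'j set) (\<S> :: 'j \<Rightarrow> 'a set set).
          (\<forall>j \<in> J. \<forall>S \<in> \<S> j. submonoid S R) \<longrightarrow>
          Spec R M \<inter> (\<Inter>j \<in> J. V_tilde R M (\<S> j)) = V_tilde R M (\<Union>j \<in> J. \<S> j))
     \<and> (\<forall>(\<S> :: 'a set set) (\<S>' :: 'a set set).
          (\<forall>S \<in> \<S>. submonoid S R) \<longrightarrow> (\<forall>S \<in> \<S>'. submonoid S R) \<longrightarrow>
          V_tilde R M \<S> \<union> V_tilde R M \<S>' =
          V_tilde R M {carrier R - colon R M P | P.
            P \<in> Spec R M \<and>
            (\<exists>A \<in> \<S>. \<exists>A' \<in> \<S>'. colon R M P \<inter> A = {} \<and> colon R M P \<inter> A' = {})})"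
proof (intro conjI allI impI)
  show "V_tilde R M {{\<one>\<^bsub>R\<^esub>}} = {}"
    by (rule module.V_tilde_one[OF assms])
qed (simp_all only: V_tilde_empty V_tilde_UN V_tilde_Un)

end
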